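(* There exists a generically ergodic Polish $\mathbb{Z}$-space $Y$ (namely an invariant dense $G_\delta$ subset of the odometer space) with the following properties: (i) there does not exist an invariant Borel probability measure on $Y$; (ii) there does not exist a non-meager Baire measurable locally weakly wandering subset of $Y$; (iii) there does not exist a Baire measurable countably generated partition of $Y$ into invariant sets, each of which admits a Baire measurable weakly wandering complete section.
   Context: A Polish $\mathbb{Z}$-space is a Polish space with a continuous $\mathbb{Z}$-action; $T$ denotes the action of $1$. The odometer space is the set of all $\alpha\in 2^{\mathbb{N}}$ having infinitely many $0$s and infinitely many $1$s, with the relative topology and the $\mathbb{Z}$-action generated by the odometer transformation $T$ (addition of $1$ with carry to the right: $T$ changes the first $0$ of $\alpha$ to $1$ and all the preceding $1$s to $0$). A Polish $\mathbb{Z}$-space is generically ergodic if every invariant set with the Baire property is meager or comeager. A set is Baire measurable if it has the Baire property. A set $A$ is weakly wandering if there is an infinite $H\subseteq\mathbb{Z}$ with $T^h(A)\cap T^{h'}(A)=\emptyset$ for all distinct $h,h'\in H$; it is locally weakly wandering if for every point $x$, the intersection of $A$ with the orbit of $x$ is weakly wandering. A complete section of an invariant set $P$ is a subset of $P$ that meets every orbit contained in $P$. A partition of $Y$ is Baire measurable countably generated if there is a countable family of Baire measurable subsets of $Y$ such that two points lie in the same piece of the partition if and only if they belong to exactly the same members of the family. *)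

theory Defs
  imports "HOL-Probability.Probability"
begin

section \<open>Baire category notions in an abstract topology\<close>

definition nowhere_dense_in :: "'a topology \<Rightarrow> 'a set \<Rightarrow> bool" where
  "nowhere_dense_in X A \<longleftrightarrow> A \<subseteq> topspace X \<and> X interior_of (X closure_of A) = {}"

definition meager_in :: "'a topology \<Rightarrow> 'a set \<Rightarrow> bool" where
  "meager_in X A \<longleftrightarrow> (\<exists>\<F>. countable \<F> \<and> (\<forall>N\<in>\<F>. nowhere_dense_in X N) \<and> A = \<Union>\<F>)"

definition comeager_in :: "'a topology \<Rightarrow> 'a set \<Rightarrow> bool" where
  "comeager_in X A \<longleftrightarrow> A \<subseteq> topspace X \<and> meager_in X (topspace X - A)"

definition baire_measurable_in :: "'a topology \<Rightarrow> 'a set \<Rightarrow> bool" where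
  "baire_measurable_in X A \<longleftrightarrow>
     A \<subseteq> topspace X \<and> (\<exists>U. openin X U \<and> meager_in X ((A - U) \<union> (U - A)))"

section \<open>Polish \<open>\<int>\<close>-spaces\<close>

definition polish_zspace :: "'a topology \<Rightarrow> (int \<Rightarrow> 'a \<Rightarrow> 'a) \<Rightarrow> bool" where
  "polish_zspace X a \<longleftrightarrow>
     completely_metrizable_space X \<and> second_countable X \<and>
     continuous_map (prod_topology (discrete_topology UNIV) X) X (\<lambda>(n, x). a n x) \<and>
     (\<forall>x\<in>topspace X. a 0 x = x \<and> (\<forall>m n. a (m + n) x = a m (a n x)))"

definition zorbit :: "(int \<Rightarrow> 'a \<Rightarrow> 'a) \<Rightarrow> 'a \<Rightarrow> 'a set" where
  "zorbit a x = range (\<lambda>n. a n x)"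

definition zinvariant :: "(int \<Rightarrow> 'a \<Rightarrow> 'a) \<Rightarrow> 'a set \<Rightarrow> bool" where
  "zinvariant a A \<longleftrightarrow> (\<forall>n. a n ` A = A)"

definition generically_ergodic :: "'a topology \<Rightarrow> (int \<Rightarrow> 'a \<Rightarrow> 'a) \<Rightarrow> bool" where
  "generically_ergodic X a \<longleftrightarrow>
     (\<forall>A. baire_measurable_in X A \<and> zinvariant a A \<longrightarrow> meager_in X A \<or> comeager_in X A)"

definition invariant_borel_prob :: "'a topology \<Rightarrow> (int \<Rightarrow> 'a \<Rightarrow> 'a) \<Rightarrow> 'a measure \<Rightarrow> bool" where
  "invariant_borel_prob X a M \<longleftrightarrow>
     prob_space M \<and> space M = topspace X \<and> sets M = sigma_sets (topspace X) {U. openin X U} \<and>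
     (\<forall>n. \<forall>B\<in>sets M. emeasure M (a n ` B) = emeasure M B)"

definition weakly_wandering :: "(int \<Rightarrow> 'a \<Rightarrow> 'a) \<Rightarrow> 'a set \<Rightarrow> bool" where
  "weakly_wandering a A \<longleftrightarrow>
     (\<exists>H. infinite H \<and> (\<forall>h\<in>H. \<forall>h'\<in>H. h \<noteq> h' \<longrightarrow> a h ` A \<inter> a h' ` A = {}))"

definition locally_weakly_wandering ::
    "'a topology \<Rightarrow> (int \<Rightarrow> 'a \<Rightarrow> 'a) \<Rightarrow> 'a set \<Rightarrow> bool" where
  "locally_weakly_wandering X a A \<longleftrightarrow>
     A \<subseteq> topspace X \<and> (\<forall>x\<in>topspace X. weakly_wandering a (A \<inter> zorbit a x))"

definition complete_section ::
    "'a topology \<Rightarrow> (int \<Rightarrow> 'a \<Rightarrow> 'a) \<Rightarrow> 'a set \<Rightarrow> 'a set \<Rightarrow> bool" where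
  "complete_section X a P S \<longleftrightarrow>
     S \<subseteq> P \<and> (\<forall>x\<in>topspace X. zorbit a x \<subseteq> P \<longrightarrow> S \<inter> zorbit a x \<noteq> {})"

definition baire_countably_generated :: "'a topology \<Rightarrow> 'a set set \<Rightarrow> bool" where
  "baire_countably_generated X \<P> \<longleftrightarrow>
     (\<exists>\<F>. countable \<F> \<and> (\<forall>B\<in>\<F>. baire_measurable_in X B) \<and>
        (\<forall>x\<in>topspace X. \<forall>y\<in>topspace X.
           (\<exists>P\<in>\<P>. x \<in> P \<and> y \<in> P) \<longleftrightarrow> (\<forall>B\<in>\<F>. x \<in> B \<longleftrightarrow> y \<in> B)))"

section \<open>The odometer\<close>

text \<open>Digits are Booleans, with \<^const>\<open>False\<close> for 0 and \<^const>\<open>True\<close> for 1; the topology on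
  \<^typ>\<open>nat \<Rightarrow> bool\<close> is the library's product topology over the discrete type \<^typ>\<open>bool\<close>.\<close>

definition odometer_space :: "(nat \<Rightarrow> bool) set" where
  "odometer_space = {\<alpha>. infinite {i. \<not> \<alpha> i} \<and> infinite {i. \<alpha> i}}"

definition odometer :: "(nat \<Rightarrow> bool) \<Rightarrow> nat \<Rightarrow> bool" where
  "odometer \<alpha> = (let k = (LEAST i. \<not> \<alpha> i)
                  in (\<lambda>i. if i < k then False else if i = k then True else \<alpha> i))"

text \<open>The inverse is taken on \<^const>\<open>odometer_space\<close>, which \<^const>\<open>odometer\<close> permutes.\<close>

definition odometer_action :: "int \<Rightarrow> (nat \<Rightarrow> bool) \<Rightarrow> nat \<Rightarrow> bool" where
  "odometer_action n =
     (if 0 \<le> n then odometer ^^ nat n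
      else inv_into odometer_space odometer ^^ nat (- n))"

end

theory Submission
  imports Defs
begin

text \<open>Take \<open>Y\<close> to be the sequences \<open>\<alpha>\<close> that vanish on \<open>{n..<2 * n}\<close> for infinitely many \<open>n\<close>. This is a
  tail condition, hence invariant, and it is \<open>G\<^sub>\<delta>\<close>. The \<open>n\<close>-th block condition
  has \<open>2 ^ n\<close> disjoint translates, so by Borel--Cantelli no invariant probability measure lives on \<open>Y\<close>.
  Orbits are dense because the action is addition modulo \<open>2 ^ n\<close> on the first \<open>n\<close> digits; this gives
  generic ergodicity, and it also makes every generic orbit return periodically to a non-meager Baire
  measurable set, which rules out weak wandering. A countably generated partition into invariant sets
  would by ergodicity have a comeager piece, whose weakly wandering complete section would be meager
  with non-meager saturation.\<close>

section \<open>Meager sets\<close>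

lemma nowhere_dense_in_subset:
  assumes "nowhere_dense_in X A" "B \<subseteq> A"
  shows "nowhere_dense_in X B"
proof -
  have "X interior_of (X closure_of B) \<subseteq> X interior_of (X closure_of A)"
    using assms(2) by (intro interior_of_mono closure_of_mono)
  with assms show ?thesis by (auto simp: nowhere_dense_in_def)
qed

lemma meager_in_subset:
  assumes "meager_in X A" "B \<subseteq> A"
  shows "meager_in X B"
proof -
  from assms(1) obtain \<F> where \<F>: "countable \<F>" "\<forall>N\<in>\<F>. nowhere_dense_in X N" "A = \<Union>\<F>"
    by (auto simp: meager_in_def)
  have "B = \<Union>((\<inter>) B ` \<F>)" using assms(2) \<F>(3) by blast
  moreover have "\<forall>N\<in>(\<inter>) B ` \<F>. nowhere_dense_in X N"
    using \<F>(2) nowhere_dense_in_subset by blast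
  ultimately show ?thesis using \<F>(1) unfolding meager_in_def by blast
qed

lemma meager_in_UN:
  assumes "countable I" "\<And>i. i \<in> I \<Longrightarrow> meager_in X (A i)"
  shows "meager_in X (\<Union>i\<in>I. A i)"
proof -
  have "\<forall>i\<in>I. \<exists>\<F>. countable \<F> \<and> (\<forall>N\<in>\<F>. nowhere_dense_in X N) \<and> A i = \<Union>\<F>"
    using assms(2) by (auto simp: meager_in_def)
  then obtain \<F> where \<F>:
    "\<forall>i\<in>I. countable (\<F> i) \<and> (\<forall>N\<in>\<F> i. nowhere_dense_in X N) \<and> A i = \<Union>(\<F> i)"
    by (rule bchoice[THEN exE])
  show ?thesis
    unfolding meager_in_def
  proof (intro exI conjI)
    show "countable (\<Union>i\<in>I. \<F> i)" using assms(1) \<F> by blast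
    show "\<forall>N\<in>(\<Union>i\<in>I. \<F> i). nowhere_dense_in X N" using \<F> by blast
    show "(\<Union>i\<in>I. A i) = \<Union>(\<Union>i\<in>I. \<F> i)" using \<F> by auto
  qed
qed

lemma meager_in_Un:
  assumes "meager_in X A" "meager_in X B"
  shows "meager_in X (A \<union> B)"
  using meager_in_UN[of "UNIV :: bool set" X "\<lambda>b. if b then A else B"] assms
  by (simp add: UNIV_bool Un_commute)

lemma meager_in_homeomorphic_image:
  assumes f: "homeomorphic_map X Y f" and A: "meager_in X A"
  shows "meager_in Y (f ` A)"
proof -
  from A obtain \<F> where \<F>: "countable \<F>" "\<forall>N\<in>\<F>. nowhere_dense_in X N" "A = \<Union>\<F>"
    by (auto simp: meager_in_def)
  have "nowhere_dense_in Y (f ` N)" if "N \<in> \<F>" for N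
  proof -
    have N: "N \<subseteq> topspace X" "X interior_of (X closure_of N) = {}"
      using \<F>(2) that by (auto simp: nowhere_dense_in_def)
    have "Y interior_of (Y closure_of (f ` N)) = {}"
      using homeomorphic_map_closure_of[OF f N(1)]
        homeomorphic_map_interior_of[OF f closure_of_subset_topspace] N(2) by simp
    then show ?thesis
      using N(1) homeomorphic_imp_surjective_map[OF f] by (auto simp: nowhere_dense_in_def)
  qed
  then have "\<forall>N\<in>(`) f ` \<F>. nowhere_dense_in Y N" by blast
  moreover have "f ` A = \<Union>((`) f ` \<F>)" using \<F>(3) by blast
  ultimately show ?thesis using \<F>(1) unfolding meager_in_def by blast
qed

text \<open>The Baire category theorem, applied to the closures of the nowhere dense sets. Its later
  use is to find a point outside a given meager set.\<close>

lemma not_meager_in_topspace: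
  assumes X: "completely_metrizable_space X" "topspace X \<noteq> {}"
  shows "\<not> meager_in X (topspace X)"
proof
  assume "meager_in X (topspace X)"
  then obtain \<F> where \<F>: "countable \<F>" "\<forall>N\<in>\<F>. nowhere_dense_in X N" "topspace X = \<Union>\<F>"
    by (auto simp: meager_in_def)
  have "X interior_of \<Union>((closure_of) X ` \<F>) = {}"
    using X(1) \<F>(1,2) by (intro Baire_category_alt) (auto simp: nowhere_dense_in_def)
  moreover have "topspace X \<subseteq> \<Union>((closure_of) X ` \<F>)"
  proof -
    have "N \<subseteq> X closure_of N" if "N \<in> \<F>" for N
      using \<F>(2) that by (intro closure_of_subset) (simp add: nowhere_dense_in_def)
    then show ?thesis unfolding \<F>(3) by blast
  qed
  then have "topspace X \<subseteq> X interior_of \<Union>((closure_of) X ` \<F>)"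
    using interior_of_mono interior_of_topspace by metis
  ultimately show False using X(2) by blast
qed

text \<open>If the open set that approximates \<open>A\<close> were empty, the symmetric difference
  would be \<open>A\<close> itself, which is not meager.\<close>

lemma nonmeager_baire_measurable_in_obtains_open:
  assumes "baire_measurable_in X A" "\<not> meager_in X A"
  obtains U where "openin X U" "U \<noteq> {}" "meager_in X (U - A)"
proof -
  from assms(1) obtain U where U: "openin X U" "meager_in X ((A - U) \<union> (U - A))"
    by (auto simp: baire_measurable_in_def)
  then have "U \<noteq> {}" using assms(2) by auto
  with U that show thesis by (meson meager_in_subset sup_ge2)
qed

section \<open>Polish \<open>\<int>\<close>-spaces\<close>

lemma zaction_continuous_map:
  assumes "polish_zspace X a"
  shows "continuous_map X X (a n)"
proof -
  have "continuous_map X (prod_topology (discrete_topology UNIV) X) (\<lambda>x. (n, x))"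
    by (simp add: continuous_map_paired)
  from continuous_map_compose[OF this, of X "\<lambda>(n, x). a n x"] assms
  show ?thesis by (simp add: polish_zspace_def o_def)
qed

lemma zaction_in_topspace:
  assumes "polish_zspace X a" "x \<in> topspace X"
  shows "a n x \<in> topspace X"
  using zaction_continuous_map[OF assms(1)] assms(2) by (auto simp: continuous_map_def)

lemma zaction_zero:
  assumes "polish_zspace X a" "x \<in> topspace X"
  shows "a 0 x = x"
  using assms by (simp add: polish_zspace_def)

lemma zaction_add:
  assumes "polish_zspace X a" "x \<in> topspace X"
  shows "a m (a n x) = a (m + n) x"
  using assms by (simp add: polish_zspace_def)

lemma zaction_homeomorphic_map:
  assumes "polish_zspace X a"
  shows "homeomorphic_map X X (a n)"
proof (rule homeomorphic_maps_imp_map)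
  show "homeomorphic_maps X X (a n) (a (- n))"
    using assms by (simp add: homeomorphic_maps_def zaction_continuous_map zaction_add zaction_zero)
qed

text \<open>Countably many homeomorphic copies of a meager set have a meager union. A point outside
  this union has its whole orbit outside \<open>A\<close>, which is how generic orbits are found
  below.\<close>

lemma meager_in_zsaturation:
  assumes "polish_zspace X a" "meager_in X A"
  shows "meager_in X (\<Union>n. a n ` A)"
  using meager_in_homeomorphic_image[OF zaction_homeomorphic_map] assms
  by (intro meager_in_UN) auto

text \<open>A non-meager invariant \<open>A\<close> with the Baire property contains all of some
  nonempty open \<open>U\<close> up to a meager set. The orbit of a point outside \<open>A\<close>
  enters \<open>U\<close> without entering \<open>A\<close>, so the complement of \<open>A\<close>
  lies in the saturation of the meager set \<open>U - A\<close>.\<close>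

lemma generically_ergodic_if_orbits_dense:
  assumes X: "polish_zspace X a"
    and dense: "\<And>U x. openin X U \<Longrightarrow> U \<noteq> {} \<Longrightarrow> x \<in> topspace X \<Longrightarrow> \<exists>n. a n x \<in> U"
  shows "generically_ergodic X a"
  unfolding generically_ergodic_def
proof (intro allI impI)
  fix A assume A: "baire_measurable_in X A \<and> zinvariant a A"
  show "meager_in X A \<or> comeager_in X A"
  proof (cases "meager_in X A")
    case False
    then obtain U where U: "openin X U" "U \<noteq> {}" "meager_in X (U - A)"
      using nonmeager_baire_measurable_in_obtains_open A by metis
    have "topspace X - A \<subseteq> (\<Union>n. a n ` (U - A))"
    proof
      fix x assume x: "x \<in> topspace X - A"
      then obtain n where n: "a n x \<in> U" using dense U by blast
      have return: "a (- n) (a n x) = x" using X x by (simp add: zaction_add zaction_zero)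
      have "a n x \<notin> A"
      proof
        assume "a n x \<in> A"
        then have "a (- n) (a n x) \<in> a (- n) ` A" by blast
        with return A x show False by (simp add: zinvariant_def)
      qed
      with n return show "x \<in> (\<Union>n. a n ` (U - A))" by (metis DiffI UN_I UNIV_I image_eqI)
    qed
    with meager_in_zsaturation[OF X U(3)] have "meager_in X (topspace X - A)"
      by (rule meager_in_subset)
    with A show ?thesis by (simp add: comeager_in_def baire_measurable_in_def)
  qed simp
qed

section \<open>Weakly wandering sets and countably generated partitions\<close>

lemma weakly_wandering_subset:
  assumes "weakly_wandering a A" "B \<subseteq> A"
  shows "weakly_wandering a B"
proof -
  have "a h ` B \<inter> a h' ` B \<subseteq> a h ` A \<inter> a h' ` A" for h h'
    using assms(2) by (intro Int_mono image_mono)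
  then show ?thesis using assms(1) unfolding weakly_wandering_def by (metis subset_empty)
qed

text \<open>Every generator is a union of invariant pieces, so ergodicity makes it meager or
  comeager. Off the countably many meager halves all points have the same pattern of membership in
  the generators, and hence lie in one piece.\<close>

lemma countably_generated_piece_comeager:
  assumes X: "polish_zspace X a" "topspace X \<noteq> {}" and ergodic: "generically_ergodic X a"
    and part: "partition_on (topspace X) \<P>" and gen: "baire_countably_generated X \<P>"
    and inv: "\<And>P. P \<in> \<P> \<Longrightarrow> zinvariant a P"
  obtains P where "P \<in> \<P>" "meager_in X (topspace X - P)"
proof -
  from gen obtain \<F> where \<F>: "countable \<F>" "\<forall>B\<in>\<F>. baire_measurable_in X B"
    and sep: "\<forall>x\<in>topspace X. \<forall>y\<in>topspace X.
      (\<exists>P\<in>\<P>. x \<in> P \<and> y \<in> P) \<longleftrightarrow> (\<forall>B\<in>\<F>. x \<in> B \<longleftrightarrow> y \<in> B)"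
    unfolding baire_countably_generated_def by (elim exE conjE)
  have sub: "B \<subseteq> topspace X" if "B \<in> \<F>" for B
    using \<F>(2) that by (simp add: baire_measurable_in_def)
  have moved: "a n x \<in> B \<longleftrightarrow> x \<in> B" if B: "B \<in> \<F>" and x: "x \<in> topspace X" for n x B
  proof -
    obtain P where P: "P \<in> \<P>" "x \<in> P" using part x by (auto simp: partition_on_def)
    then have "a n x \<in> P" using inv unfolding zinvariant_def by blast
    with sep P B x zaction_in_topspace[OF X(1), of x n] show ?thesis by blast
  qed
  have "zinvariant a B" if B: "B \<in> \<F>" for B
    unfolding zinvariant_def
  proof (intro allI subset_antisym subsetI)
    fix n x assume "x \<in> a n ` B"
    then show "x \<in> B" using moved B sub by blast
  next
    fix n x assume x: "x \<in> B"
    then have "a n (a (- n) x) = x" "a (- n) x \<in> B"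
      using sub[OF B] X(1) moved[OF B] by (auto simp: zaction_add zaction_zero)
    then show "x \<in> a n ` B" by (metis imageI)
  qed
  then have zero_one: "meager_in X B \<or> meager_in X (topspace X - B)" if "B \<in> \<F>" for B
    using ergodic \<F>(2) that by (auto simp: generically_ergodic_def comeager_in_def)
  \<comment> \<open>\<open>N B\<close> is the meager one of \<open>B\<close> and its complement, as
    \<open>zero_one\<close> guarantees.\<close>
  define N where "N B = (if meager_in X B then B else topspace X - B)" for B
  have meager: "meager_in X (\<Union>B\<in>\<F>. N B)"
    using \<F>(1) zero_one by (intro meager_in_UN) (auto simp: N_def)
  \<comment> \<open>By Baire category some point \<open>x\<close> avoids every \<open>N B\<close>;
    the piece of \<open>x\<close> is the comeager one.\<close>
  have "\<not> topspace X \<subseteq> (\<Union>B\<in>\<F>. N B)"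
    using meager_in_subset[OF meager] not_meager_in_topspace X by (auto simp: polish_zspace_def)
  then obtain x where x: "x \<in> topspace X" "x \<notin> (\<Union>B\<in>\<F>. N B)" by blast
  then obtain P where P: "P \<in> \<P>" "x \<in> P" using part by (auto simp: partition_on_def)
  have "y \<in> P" if y: "y \<in> topspace X" "y \<notin> (\<Union>B\<in>\<F>. N B)" for y
  proof -
    have "x \<in> B \<longleftrightarrow> y \<in> B" if "B \<in> \<F>" for B
      using x y that by (auto simp: N_def split: if_splits)
    then obtain Q where "Q \<in> \<P>" "x \<in> Q" "y \<in> Q" using sep x(1) y(1) by blast
    with P part show ?thesis by (auto simp: partition_on_def disjoint_def)
  qed
  then have "topspace X - P \<subseteq> (\<Union>B\<in>\<F>. N B)" by blast
  with P(1) that meager_in_subset[OF meager] show thesis by blast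
qed

text \<open>The section \<open>S\<close> of the comeager piece \<open>P\<close> is weakly wandering
  on every orbit, hence meager by \<open>nolww\<close>. Its saturation is then meager and covers
  \<open>P\<close>, so the whole space would be meager.\<close>

lemma no_countably_generated_wandering_partition:
  assumes X: "polish_zspace X a" "topspace X \<noteq> {}" and ergodic: "generically_ergodic X a"
    and nolww: "\<And>A. baire_measurable_in X A \<Longrightarrow> locally_weakly_wandering X a A \<Longrightarrow> meager_in X A"
    and part: "partition_on (topspace X) \<P>" and gen: "baire_countably_generated X \<P>"
    and pieces: "\<And>P. P \<in> \<P> \<Longrightarrow> zinvariant a P \<and>
      (\<exists>S. baire_measurable_in X S \<and> weakly_wandering a S \<and> complete_section X a P S)"
  shows False
proof -
  obtain P where P: "P \<in> \<P>" "meager_in X (topspace X - P)"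
    using countably_generated_piece_comeager[OF X ergodic part gen] pieces by blast
  then obtain S where S: "baire_measurable_in X S" "weakly_wandering a S" "complete_section X a P S"
    and inv: "zinvariant a P"
    using pieces by blast
  have "locally_weakly_wandering X a S"
    using S weakly_wandering_subset[OF S(2)]
    by (auto simp: locally_weakly_wandering_def baire_measurable_in_def)
  with S nolww have "meager_in X (\<Union>n. a n ` S)" using meager_in_zsaturation[OF X(1)] by blast
  moreover have "P \<subseteq> (\<Union>n. a n ` S)"
  proof
    fix x assume x: "x \<in> P"
    then have xX: "x \<in> topspace X" using part P(1) by (auto simp: partition_on_def)
    have "zorbit a x \<subseteq> P" using x inv unfolding zorbit_def zinvariant_def by blast
    then obtain n where "a n x \<in> S"
      using S(3) xX unfolding complete_section_def zorbit_def by blast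
    moreover have "a (- n) (a n x) = x" using X(1) xX by (simp add: zaction_add zaction_zero)
    ultimately show "x \<in> (\<Union>n. a n ` S)" by (metis UN_I UNIV_I image_eqI)
  qed
  ultimately have "meager_in X ((topspace X - P) \<union> P)"
    using P(2) by (blast intro: meager_in_Un meager_in_subset)
  then show False
    using not_meager_in_topspace X meager_in_subset
    by (metis Diff_partition Un_Diff_cancel2 Un_upper1 polish_zspace_def)
qed

section \<open>The odometer\<close>

lemma odometer_first_zero:
  assumes "\<alpha> \<in> odometer_space"
  obtains k where "\<not> \<alpha> k" "\<And>i. i < k \<Longrightarrow> \<alpha> i"
    "odometer \<alpha> = (\<lambda>i. if i < k then False else if i = k then True else \<alpha> i)"
proof -
  have "{i. \<not> \<alpha> i} \<noteq> {}" using assms by (force simp: odometer_space_def)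
  then have "\<not> \<alpha> (LEAST i. \<not> \<alpha> i)" by (metis (mono_tags) LeastI_ex empty_Collect_eq)
  moreover have "\<alpha> i" if "i < (LEAST i. \<not> \<alpha> i)" for i using not_less_Least[OF that] by simp
  ultimately show thesis by (rule that) (simp_all add: odometer_def Let_def)
qed

text \<open>The equivalence relation E_0. Since the action moves points only within its classes,
  tail conditions define invariant sets.\<close>

definition tail_equiv :: "(nat \<Rightarrow> 'a) \<Rightarrow> (nat \<Rightarrow> 'a) \<Rightarrow> bool" where
  "tail_equiv \<alpha> \<beta> \<longleftrightarrow> (\<exists>N. \<forall>i\<ge>N. \<alpha> i = \<beta> i)"

lemma tail_equiv_sym: "tail_equiv \<alpha> \<beta> \<Longrightarrow> tail_equiv \<beta> \<alpha>"
  unfolding tail_equiv_def by metis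

lemma tail_equiv_trans:
  assumes "tail_equiv \<alpha> \<beta>" "tail_equiv \<beta> \<gamma>"
  shows "tail_equiv \<alpha> \<gamma>"
proof -
  from assms obtain M N where "\<forall>i\<ge>M. \<alpha> i = \<beta> i" "\<forall>i\<ge>N. \<beta> i = \<gamma> i"
    by (auto simp: tail_equiv_def)
  then have "\<forall>i\<ge>max M N. \<alpha> i = \<gamma> i" by simp
  then show ?thesis unfolding tail_equiv_def by blast
qed

lemma infinite_tail_equiv:
  assumes "tail_equiv \<alpha> \<beta>" "infinite {i. P (\<alpha> i)}"
  shows "infinite {i. P (\<beta> i)}"
proof -
  from assms(1) obtain N where N: "\<forall>i\<ge>N. \<alpha> i = \<beta> i" by (auto simp: tail_equiv_def)
  have "{i. P (\<alpha> i)} \<subseteq> {..<N} \<union> {i. P (\<beta> i)}" using N by (auto simp: not_less)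
  with assms(2) show ?thesis using finite_subset by blast
qed

lemma odometer_space_tail_equiv:
  assumes "tail_equiv \<alpha> \<beta>" "\<alpha> \<in> odometer_space"
  shows "\<beta> \<in> odometer_space"
  using assms infinite_tail_equiv[of \<alpha> \<beta> "\<lambda>b. b"] infinite_tail_equiv[of \<alpha> \<beta> "\<lambda>b. \<not> b"]
  by (simp add: odometer_space_def)

lemma tail_equiv_odometer:
  assumes "\<alpha> \<in> odometer_space"
  shows "tail_equiv \<alpha> (odometer \<alpha>)"
proof -
  obtain k where "odometer \<alpha> = (\<lambda>i. if i < k then False else if i = k then True else \<alpha> i)"
    using odometer_first_zero[OF assms] by metis
  then have "\<forall>i\<ge>Suc k. \<alpha> i = odometer \<alpha> i" by simp
  then show ?thesis unfolding tail_equiv_def by blast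
qed

section \<open>Binary values of prefixes, and the odometer as addition modulo
  \<open>2 ^ n\<close>\<close>

definition prefix_value :: "nat \<Rightarrow> (nat \<Rightarrow> bool) \<Rightarrow> int" where
  "prefix_value n \<alpha> = (\<Sum>i<n. of_bool (\<alpha> i) * 2 ^ i)"

lemma prefix_value_Suc: "prefix_value (Suc n) \<alpha> = prefix_value n \<alpha> + of_bool (\<alpha> n) * 2 ^ n"
  by (simp add: prefix_value_def)

lemma prefix_value_bounds: "0 \<le> prefix_value n \<alpha> \<and> prefix_value n \<alpha> < 2 ^ n"
  by (induction n) (auto simp: prefix_value_def)

lemma prefix_value_mod: "prefix_value n \<alpha> mod 2 ^ n = prefix_value n \<alpha>"
  using prefix_value_bounds by simp

text \<open>Uniqueness of binary expansions: digit \<open>n\<close> contributes 0 or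
  \<open>2 ^ n\<close>, while the lower digits contribute less than \<open>2 ^ n\<close>.\<close>

lemma prefix_value_eq_iff: "prefix_value n \<alpha> = prefix_value n \<beta> \<longleftrightarrow> (\<forall>i<n. \<alpha> i = \<beta> i)"
proof (induction n)
  case (Suc n)
  have "prefix_value (Suc n) \<alpha> = prefix_value (Suc n) \<beta> \<longleftrightarrow>
      prefix_value n \<alpha> = prefix_value n \<beta> \<and> \<alpha> n = \<beta> n"
    using prefix_value_bounds[of n \<alpha>] prefix_value_bounds[of n \<beta>]
    by (auto simp: prefix_value_Suc of_bool_def split: if_splits)
  with Suc show ?case by (auto simp: less_Suc_eq)
qed (simp add: prefix_value_def)

text \<open>With \<open>n\<close> and \<open>2 * n\<close> as the two lengths, this turns a block of
  zeros into the bound \<open>prefix_value (2 * n) \<alpha> < 2 ^ n\<close>.\<close>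

lemma prefix_value_zero_block:
  assumes "m \<le> n" "\<And>i. m \<le> i \<Longrightarrow> i < n \<Longrightarrow> \<not> \<alpha> i"
  shows "prefix_value n \<alpha> = prefix_value m \<alpha>"
  using assms by (induction n rule: dec_induct) (auto simp: prefix_value_Suc)

lemma prefix_value_odometer:
  assumes "\<alpha> \<in> odometer_space"
  shows "prefix_value n (odometer \<alpha>) = (prefix_value n \<alpha> + 1) mod 2 ^ n"
proof -
  obtain k where k: "\<not> \<alpha> k" "\<And>i. i < k \<Longrightarrow> \<alpha> i"
    "odometer \<alpha> = (\<lambda>i. if i < k then False else if i = k then True else \<alpha> i)"
    using odometer_first_zero[OF assms] by blast
  \<comment> \<open>Exact addition before reduction: \<open>of_bool (n \<le> k)\<close> is the carry
    out of the first \<open>n\<close> digits, which occurs when all of them are 1.\<close>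
  have "prefix_value n (odometer \<alpha>) + of_bool (n \<le> k) * 2 ^ n = prefix_value n \<alpha> + 1"
  proof (induction n)
    case (Suc n)
    consider "n < k" | "n = k" | "n > k" by linarith
    then show ?case
      using Suc k by cases (auto simp: prefix_value_Suc)
  qed (simp add: prefix_value_def)
  then have "(prefix_value n \<alpha> + 1) mod 2 ^ n = prefix_value n (odometer \<alpha>) mod 2 ^ n"
    by (metis mod_mult_self1)
  then show ?thesis by (simp add: prefix_value_mod)
qed

text \<open>Adding 1 is injective modulo \<open>2 ^ Suc i\<close>, so the image determines digit
  \<open>i\<close> for each \<open>i\<close>. For surjectivity a preimage is written down.\<close>

lemma bij_betw_odometer: "bij_betw odometer odometer_space odometer_space"
  unfolding bij_betw_def
proof (intro conjI subset_antisym subsetI)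
  show "inj_on odometer odometer_space"
  proof (rule inj_onI, rule ext)
    fix \<alpha> \<beta> i
    assume H: "\<alpha> \<in> odometer_space" "\<beta> \<in> odometer_space" "odometer \<alpha> = odometer \<beta>"
    then have "(prefix_value (Suc i) \<alpha> + 1) mod 2 ^ Suc i = (prefix_value (Suc i) \<beta> + 1) mod 2 ^ Suc i"
      using prefix_value_odometer by metis
    then have "prefix_value (Suc i) \<alpha> mod 2 ^ Suc i = prefix_value (Suc i) \<beta> mod 2 ^ Suc i"
      by (metis add_diff_cancel_right' mod_diff_left_eq)
    then show "\<alpha> i = \<beta> i" unfolding prefix_value_mod prefix_value_eq_iff by simp
  qed
next
  fix \<beta> assume "\<beta> \<in> odometer ` odometer_space"
  then show "\<beta> \<in> odometer_space" using tail_equiv_odometer odometer_space_tail_equiv by blast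
next
  fix \<beta> assume \<beta>: "\<beta> \<in> odometer_space"
  \<comment> \<open>The preimage is \<open>\<beta>\<close> minus 1, with borrow: the first 1 becomes
    0 and the zeros before it become 1.\<close>
  define k where "k = (LEAST i. \<beta> i)"
  define \<alpha> where "\<alpha> = (\<lambda>i. if i < k then True else if i = k then False else \<beta> i)"
  have "{i. \<beta> i} \<noteq> {}" using \<beta> by (force simp: odometer_space_def)
  then have k: "\<beta> k" "\<And>i. i < k \<Longrightarrow> \<not> \<beta> i"
    unfolding k_def by (metis LeastI_ex empty_Collect_eq) (rule not_less_Least)
  have "\<forall>i\<ge>Suc k. \<beta> i = \<alpha> i" by (simp add: \<alpha>_def)
  then have "\<alpha> \<in> odometer_space"
    using odometer_space_tail_equiv \<beta> unfolding tail_equiv_def by blast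
  moreover have "(LEAST i. \<not> \<alpha> i) = k"
    by (rule Least_equality) (auto simp: \<alpha>_def split: if_splits)
  then have "odometer \<alpha> = \<beta>" using k by (auto simp: odometer_def \<alpha>_def fun_eq_iff)
  ultimately show "\<beta> \<in> odometer ` odometer_space" by blast
qed

lemma inv_odometer:
  assumes "\<alpha> \<in> odometer_space"
  shows "inv_into odometer_space odometer \<alpha> \<in> odometer_space"
    "odometer (inv_into odometer_space odometer \<alpha>) = \<alpha>"
    "inv_into odometer_space odometer (odometer \<alpha>) = \<alpha>"
  using assms bij_betw_odometer
  by (auto simp: bij_betw_def f_inv_into_f intro: inv_into_into inv_into_f_f)

section \<open>The integer action generated by the odometer\<close>

lemma odometer_action_0: "odometer_action 0 \<alpha> = \<alpha>"
  by (simp add: odometer_action_def)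

lemma odometer_in_odometer_space: "\<alpha> \<in> odometer_space \<Longrightarrow> odometer \<alpha> \<in> odometer_space"
  using bij_betw_odometer by (auto simp: bij_betw_def)

lemma funpow_in: "(\<And>x. x \<in> A \<Longrightarrow> f x \<in> A) \<Longrightarrow> x \<in> A \<Longrightarrow> (f ^^ n) x \<in> A"
  by (induction n) auto

lemma odometer_action_in_odometer_space:
  assumes "\<alpha> \<in> odometer_space"
  shows "odometer_action n \<alpha> \<in> odometer_space"
  using assms unfolding odometer_action_def
  by (auto intro!: funpow_in odometer_in_odometer_space inv_odometer(1))

text \<open>This recurrence replaces the sign distinction in the definition, so that later proofs
  can use two-sided induction on integers. At \<open>n = -1\<close> the two branches meet, because
  exponent 0 gives the identity in both.\<close>

lemma odometer_action_Suc:
  assumes "\<alpha> \<in> odometer_space"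
  shows "odometer_action (n + 1) \<alpha> = odometer (odometer_action n \<alpha>)"
proof (cases "0 \<le> n")
  case True
  then show ?thesis by (simp add: odometer_action_def nat_add_distrib)
next
  case False
  then have "nat (- n) = Suc (nat (- (n + 1)))" by simp
  then have "odometer_action n \<alpha> = inv_into odometer_space odometer (odometer_action (n + 1) \<alpha>)"
    using False by (simp add: odometer_action_def del: minus_add_distrib)
  then show ?thesis
    using inv_odometer(2) odometer_action_in_odometer_space assms by metis
qed

lemma odometer_action_pred:
  assumes "\<alpha> \<in> odometer_space"
  shows "odometer (odometer_action (n - 1) \<alpha>) = odometer_action n \<alpha>"
  using odometer_action_Suc[OF assms, of "n - 1"] by simp

lemma odometer_action_add:
  assumes "\<alpha> \<in> odometer_space"
  shows "odometer_action (m + n) \<alpha> = odometer_action m (odometer_action n \<alpha>)"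
proof (induction m rule: int_induct[where k = 0])
  case base
  then show ?case by (simp add: odometer_action_0)
next
  case (step1 m)
  then show ?case
    using odometer_action_Suc assms odometer_action_in_odometer_space
    by (metis add.commute add.left_commute)
next
  case (step2 m)
  let ?\<beta> = "odometer_action n \<alpha>"
  \<comment> \<open>For the downward step, \<open>odometer\<close> is applied to both sides, which
    reduces them to the case \<open>m\<close>; it is then cancelled by injectivity.\<close>
  have "odometer (odometer_action (m + n - 1) \<alpha>) = odometer (odometer_action (m - 1) ?\<beta>)"
    using step2 odometer_action_pred assms odometer_action_in_odometer_space by metis
  then have "odometer_action (m + n - 1) \<alpha> = odometer_action (m - 1) ?\<beta>"
    using bij_betw_odometer assms odometer_action_in_odometer_space
    by (metis bij_betw_def inj_onD)
  then show ?case by (simp add: algebra_simps)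
qed

lemma tail_equiv_odometer_action:
  assumes "\<alpha> \<in> odometer_space"
  shows "tail_equiv \<alpha> (odometer_action n \<alpha>)"
proof (induction n rule: int_induct[where k = 0])
  case base
  then show ?case by (simp add: odometer_action_0 tail_equiv_def)
next
  case (step1 n)
  then show ?case
    using tail_equiv_odometer tail_equiv_trans odometer_action_Suc assms
      odometer_action_in_odometer_space by metis
next
  case (step2 n)
  then show ?case
    using tail_equiv_odometer tail_equiv_trans tail_equiv_sym odometer_action_pred assms
      odometer_action_in_odometer_space by metis
qed

text \<open>Iterates \<open>prefix_value_odometer\<close> in both directions; integer-valued
  prefixes let negative \<open>k\<close> obey the same formula. Dense orbits, continuity, periodic
  returns and disjoint translates are all read off from it.\<close>

lemma prefix_value_odometer_action:
  assumes "\<alpha> \<in> odometer_space"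
  shows "prefix_value n (odometer_action k \<alpha>) = (prefix_value n \<alpha> + k) mod 2 ^ n"
proof (induction k rule: int_induct[where k = 0])
  case base
  then show ?case by (simp add: odometer_action_0 prefix_value_mod)
next
  case (step1 k)
  have "prefix_value n (odometer_action (k + 1) \<alpha>) = (prefix_value n (odometer_action k \<alpha>) + 1) mod 2 ^ n"
    using prefix_value_odometer odometer_action_Suc assms odometer_action_in_odometer_space
    by metis
  also have "\<dots> = (prefix_value n \<alpha> + (k + 1)) mod 2 ^ n"
    by (simp add: step1 mod_add_left_eq add.assoc)
  finally show ?case .
next
  case (step2 k)
  let ?v = "prefix_value n (odometer_action (k - 1) \<alpha>)"
  have "(?v + 1) mod 2 ^ n = prefix_value n (odometer_action k \<alpha>)"
    using prefix_value_odometer odometer_action_pred assms odometer_action_in_odometer_space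
    by metis
  then have "(?v + 1) mod 2 ^ n = (prefix_value n \<alpha> + k) mod 2 ^ n" using step2 by simp
  then have "(?v + 1 - 1) mod 2 ^ n = (prefix_value n \<alpha> + k - 1) mod 2 ^ n"
    by (rule mod_diff_cong) simp
  then show ?case by (simp add: prefix_value_mod algebra_simps)
qed

section \<open>Cylinder sets and the topology of the action\<close>

lemma open_prefix_neighbourhood:
  fixes U :: "(nat \<Rightarrow> bool) set"
  assumes "open U" "\<alpha> \<in> U"
  obtains n where "\<And>\<beta>. prefix_value n \<beta> = prefix_value n \<alpha> \<Longrightarrow> \<beta> \<in> U"
proof -
  have "openin (product_topology (\<lambda>_. euclidean) UNIV) U"
    using assms(1) by (simp add: open_fun_def)
  then obtain V where V: "finite {i. V i \<noteq> (UNIV :: bool set)}" "\<alpha> \<in> Pi\<^sub>E UNIV V" "Pi\<^sub>E UNIV V \<subseteq> U"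
    using assms(2) by (auto simp: openin_product_topology_alt)
  \<comment> \<open>A basic open set restricts finitely many coordinates, so some \<open>n\<close>
    exceeds them all.\<close>
  then obtain n where n: "\<And>i. V i \<noteq> UNIV \<Longrightarrow> i < n"
    using finite_nat_set_iff_bounded by auto
  have "\<beta> \<in> U" if "prefix_value n \<beta> = prefix_value n \<alpha>" for \<beta>
  proof -
    have "\<beta> i \<in> V i" for i
      using that n[of i] V(2) unfolding prefix_value_eq_iff by (cases "V i = UNIV") (auto simp: PiE_iff)
    then show ?thesis using V(3) by auto
  qed
  with that show thesis by blast
qed

text \<open>Membership depends on the first \<open>n\<close> digits only, so the set is a union of
  cylinders.\<close>

lemma open_prefix_value_vimage: "open {\<alpha>. prefix_value n \<alpha> \<in> V}"
proof -
  have "open {\<beta>. \<forall>i<n. \<beta> i = \<alpha> i}" for \<alpha> :: "nat \<Rightarrow> bool"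
  proof -
    have "open ((\<lambda>\<beta>. \<beta> i) -` {\<alpha> i})" for i
      by (intro open_vimage discrete_topology_class.open_discrete continuous_on_product_coordinates)
    then have "open (\<Inter>i\<in>{..<n}. (\<lambda>\<beta>. \<beta> i) -` {\<alpha> i})" by blast
    then show ?thesis by (simp add: vimage_def INTER_eq lessThan_def)
  qed
  then have "open (\<Union>\<alpha>\<in>{\<alpha>. prefix_value n \<alpha> \<in> V}. {\<beta>. \<forall>i<n. \<beta> i = \<alpha> i})" by blast
  moreover have "(\<Union>\<alpha>\<in>{\<alpha>. prefix_value n \<alpha> \<in> V}. {\<beta>. \<forall>i<n. \<beta> i = \<alpha> i}) = {\<alpha>. prefix_value n \<alpha> \<in> V}"
    unfolding prefix_value_eq_iff[symmetric] by auto
  ultimately show ?thesis by simp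
qed

text \<open>Moving by the difference of two prefix values carries \<open>\<alpha>\<close> into any
  prescribed cylinder.\<close>

lemma odometer_orbit_dense:
  assumes "\<alpha> \<in> odometer_space" "open U" "U \<noteq> {}"
  shows "\<exists>k. odometer_action k \<alpha> \<in> U"
proof -
  obtain \<beta> where "\<beta> \<in> U" using assms(3) by blast
  then obtain n where n: "\<And>\<gamma>. prefix_value n \<gamma> = prefix_value n \<beta> \<Longrightarrow> \<gamma> \<in> U"
    using open_prefix_neighbourhood[OF assms(2)] by metis
  have "prefix_value n (odometer_action (prefix_value n \<beta> - prefix_value n \<alpha>) \<alpha>) = prefix_value n \<beta>"
    using assms(1) by (simp add: prefix_value_odometer_action prefix_value_mod)
  with n show ?thesis by blast
qed

text \<open>The first \<open>n\<close> digits of the image depend only on the first \<open>n\<close>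
  digits of the argument, so a cylinder of the same length serves as the neighbourhood.\<close>

lemma odometer_action_continuous_on: "continuous_on odometer_space (odometer_action k)"
  unfolding continuous_on_topological
proof (intro ballI allI impI)
  fix \<alpha> U assume \<alpha>: "\<alpha> \<in> odometer_space" and U: "open U" "odometer_action k \<alpha> \<in> U"
  then obtain n where n: "\<And>\<beta>. prefix_value n \<beta> = prefix_value n (odometer_action k \<alpha>) \<Longrightarrow> \<beta> \<in> U"
    using open_prefix_neighbourhood by metis
  show "\<exists>W. open W \<and> \<alpha> \<in> W \<and> (\<forall>\<beta>\<in>odometer_space. \<beta> \<in> W \<longrightarrow> odometer_action k \<beta> \<in> U)"
  proof (intro exI conjI ballI impI)
    show "open {\<beta>. prefix_value n \<beta> \<in> {prefix_value n \<alpha>}}" by (rule open_prefix_value_vimage)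
  qed (use n \<alpha> in \<open>auto simp: prefix_value_odometer_action\<close>)
qed

text \<open>A \<open>G\<^sub>\<delta>\<close> subset of Cantor space is completely metrizable, and
  the cylinders form a countable base.\<close>

lemma polish_zspace_odometer:
  assumes Y: "Y \<subseteq> odometer_space" "zinvariant odometer_action Y" "gdelta_in euclidean Y"
  shows "polish_zspace (top_of_set Y) odometer_action"
  unfolding polish_zspace_def
proof (intro conjI ballI allI)
  have bool_discrete: "(euclidean :: bool topology) = discrete_topology UNIV"
    by (simp add: topology_eq open_openin[symmetric] discrete_topology_class.open_discrete)
  have "completely_metrizable_space (euclidean :: (nat \<Rightarrow> bool) topology)"
    unfolding euclidean_product_topology[symmetric] completely_metrizable_space_product_topology
    by (simp add: bool_discrete completely_metrizable_space_discrete_topology)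
  with Y(3) show "completely_metrizable_space (top_of_set Y)"
    by (rule completely_metrizable_space_gdelta_in[rotated])
  have "second_countable (euclidean :: (nat \<Rightarrow> bool) topology)"
    unfolding second_countable_def
  proof (intro exI conjI ballI allI impI)
    let ?\<B> = "(\<lambda>(n, v). {\<alpha>. prefix_value n \<alpha> \<in> {v}}) ` UNIV"
    show "countable ?\<B>" by (intro countable_image countableI_type)
    show "openin euclidean V" if V: "V \<in> ?\<B>" for V
    proof -
      obtain n v where "V = {\<alpha>. prefix_value n \<alpha> \<in> {v}}" using V by auto
      then show ?thesis using open_prefix_value_vimage[of n "{v}"] by simp
    qed
    fix U and \<alpha> :: "nat \<Rightarrow> bool" assume U: "openin euclidean U \<and> \<alpha> \<in> U"
    then obtain n where n: "\<And>\<beta>. prefix_value n \<beta> = prefix_value n \<alpha> \<Longrightarrow> \<beta> \<in> U"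
      using open_prefix_neighbourhood by (metis open_openin)
    show "\<exists>V\<in>?\<B>. \<alpha> \<in> V \<and> V \<subseteq> U"
    proof (rule bexI)
      show "{\<beta>. prefix_value n \<beta> \<in> {prefix_value n \<alpha>}} \<in> ?\<B>"
        by (rule image_eqI[of _ _ "(n, prefix_value n \<alpha>)"]) simp_all
    qed (use n in auto)
  qed
  then show "second_countable (top_of_set Y)" by (rule second_countable_subtopology)
  show "odometer_action 0 \<alpha> = \<alpha>" for \<alpha> by (rule odometer_action_0)
  show "odometer_action (m + n) \<alpha> = odometer_action m (odometer_action n \<alpha>)"
    if "\<alpha> \<in> topspace (top_of_set Y)" for \<alpha> m n
    using that Y(1) by (intro odometer_action_add) auto
  show "continuous_map (prod_topology (discrete_topology UNIV) (top_of_set Y)) (top_of_set Y)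
    (\<lambda>(n, \<alpha>). odometer_action n \<alpha>)"
    unfolding continuous_map_def
  proof (intro conjI allI impI)
    show "(\<lambda>(n, \<alpha>). odometer_action n \<alpha>)
      \<in> topspace (prod_topology (discrete_topology UNIV) (top_of_set Y)) \<rightarrow> topspace (top_of_set Y)"
      using Y(2) by (auto simp: zinvariant_def)
    fix U assume U: "openin (top_of_set Y) U"
    have "continuous_map (top_of_set Y) (top_of_set Y) (odometer_action n)" for n
      using continuous_on_subset[OF odometer_action_continuous_on Y(1)] Y(2)
      by (auto simp: continuous_map_in_subtopology zinvariant_def)
    then have "openin (top_of_set Y) {\<alpha> \<in> Y. odometer_action n \<alpha> \<in> U}" for n
      using openin_continuous_map_preimage[OF _ U, of "top_of_set Y"] by simp
    \<comment> \<open>The integers are discrete, so joint continuity reduces to slices: the preimage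
      is a union of open slices, one for each \<open>n\<close>.\<close>
    then have "openin (prod_topology (discrete_topology UNIV) (top_of_set Y))
        (\<Union>n. {n} \<times> {\<alpha> \<in> Y. odometer_action n \<alpha> \<in> U})"
      by (intro openin_Union ballI) (auto simp: openin_prod_Times_iff)
    moreover have "(\<Union>n. {n} \<times> {\<alpha> \<in> Y. odometer_action n \<alpha> \<in> U}) =
        {p \<in> topspace (prod_topology (discrete_topology UNIV) (top_of_set Y)).
          (case p of (n, \<alpha>) \<Rightarrow> odometer_action n \<alpha>) \<in> U}"
      by auto
    ultimately show "openin (prod_topology (discrete_topology UNIV) (top_of_set Y))
        {p \<in> topspace (prod_topology (discrete_topology UNIV) (top_of_set Y)).
          (case p of (n, \<alpha>) \<Rightarrow> odometer_action n \<alpha>) \<in> U}"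
      by simp
  qed
qed

text \<open>On a generic orbit, the return times to a non-meager Baire measurable set contain a residue
  class modulo some \<open>2 ^ n\<close>; two elements of \<open>H\<close> that agree modulo \<open>2 ^ n\<close> then give
  intersecting translates.\<close>

lemma odometer_locally_weakly_wandering_meager:
  assumes Y: "polish_zspace (top_of_set Y) odometer_action" "Y \<subseteq> odometer_space" "Y \<noteq> {}"
    and A: "baire_measurable_in (top_of_set Y) A"
      "locally_weakly_wandering (top_of_set Y) odometer_action A"
  shows "meager_in (top_of_set Y) A"
proof (rule ccontr)
  assume "\<not> meager_in (top_of_set Y) A"
  then obtain U where U: "openin (top_of_set Y) U" "U \<noteq> {}" "meager_in (top_of_set Y) (U - A)"
    using nonmeager_baire_measurable_in_obtains_open[OF A(1)] by metis
  obtain V \<gamma> where V: "open V" "U = Y \<inter> V" "\<gamma> \<in> V"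
    using U(1,2) by (auto simp: openin_open)
  then obtain n where n: "\<And>\<beta>. prefix_value n \<beta> = prefix_value n \<gamma> \<Longrightarrow> \<beta> \<in> V"
    using open_prefix_neighbourhood by metis
  have inY: "odometer_action k \<alpha> \<in> Y" if "\<alpha> \<in> Y" for k \<alpha>
    using zaction_in_topspace[OF Y(1)] that by simp
  \<comment> \<open>The orbit of a point outside \<open>M\<close> never meets \<open>U - A\<close>,
    so it is in \<open>A\<close> whenever it is in \<open>U\<close>.\<close>
  define M where "M = (\<Union>k. odometer_action k ` (U - A))"
  have "\<not> Y \<subseteq> M"
    using meager_in_zsaturation[OF Y(1) U(3)] not_meager_in_topspace[of "top_of_set Y"] Y(1,3)
    by (auto simp: M_def polish_zspace_def dest: meager_in_subset)
  then obtain \<alpha> where \<alpha>: "\<alpha> \<in> Y" "\<alpha> \<notin> M" by blast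
  have \<alpha>X: "\<alpha> \<in> odometer_space" using \<alpha>(1) Y(2) by blast
  have inA: "odometer_action k \<alpha> \<in> A"
    if k: "prefix_value n (odometer_action k \<alpha>) = prefix_value n \<gamma>" for k
  proof (rule ccontr)
    assume "odometer_action k \<alpha> \<notin> A"
    then have "odometer_action k \<alpha> \<in> U - A" using n[OF k] inY[OF \<alpha>(1)] V(2) by blast
    moreover have "odometer_action (- k) (odometer_action k \<alpha>) = \<alpha>"
      using odometer_action_add[OF \<alpha>X, of "- k" k] by (simp add: odometer_action_0)
    ultimately have "\<alpha> \<in> M" unfolding M_def by (metis UN_I UNIV_I image_eqI)
    with \<alpha>(2) show False by blast
  qed
  have "weakly_wandering odometer_action (A \<inter> zorbit odometer_action \<alpha>)"
    using A(2) \<alpha>(1) by (simp add: locally_weakly_wandering_def)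
  then obtain H where H: "infinite H" and disj: "\<forall>h\<in>H. \<forall>h'\<in>H. h \<noteq> h' \<longrightarrow>
      odometer_action h ` (A \<inter> zorbit odometer_action \<alpha>) \<inter>
      odometer_action h' ` (A \<inter> zorbit odometer_action \<alpha>) = {}"
    unfolding weakly_wandering_def by (elim exE conjE)
  \<comment> \<open>Pigeonhole: the infinite set \<open>H\<close> has only \<open>2 ^ n\<close>
    residues available.\<close>
  have "\<not> inj_on (\<lambda>h. h mod 2 ^ n) H"
  proof
    assume "inj_on (\<lambda>h. h mod 2 ^ n) H"
    moreover have "(\<lambda>h::int. h mod 2 ^ n) ` H \<subseteq> {0..<2 ^ n}" by auto
    ultimately show False using H inj_on_finite by blast
  qed
  then obtain h h' where h: "h \<in> H" "h' \<in> H" "h \<noteq> h'" "h mod 2 ^ n = h' mod 2 ^ n"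
    by (auto simp: inj_on_def)
  \<comment> \<open>Both \<open>k\<close> and \<open>h - h' + k\<close> are return times to the
    cylinder of \<open>\<gamma>\<close>. Translating the two returned points by \<open>h\<close> and
    \<open>h'\<close> respectively gives the same point, at time \<open>h + k\<close>.\<close>
  define k where "k = prefix_value n \<gamma> - prefix_value n \<alpha>"
  have k: "prefix_value n (odometer_action k \<alpha>) = prefix_value n \<gamma>"
    using \<alpha>X by (simp add: prefix_value_odometer_action prefix_value_mod k_def)
  have "(prefix_value n \<alpha> + (h - h' + k)) mod 2 ^ n = ((prefix_value n \<alpha> + k) + (h - h')) mod 2 ^ n"
    by (simp add: algebra_simps)
  also have "\<dots> = (prefix_value n \<alpha> + k) mod 2 ^ n"
    using h(4) by (metis add.right_neutral mod_0_imp_dvd mod_add_right_eq mod_eq_dvd_iff dvd_imp_mod_0)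
  finally have k': "prefix_value n (odometer_action (h - h' + k) \<alpha>) = prefix_value n \<gamma>"
    using k \<alpha>X by (simp add: prefix_value_odometer_action)
  have "odometer_action h (odometer_action k \<alpha>) = odometer_action h' (odometer_action (h - h' + k) \<alpha>)"
    using odometer_action_add[OF \<alpha>X] by (metis add.assoc add.commute diff_add_cancel)
  moreover have "odometer_action k \<alpha> \<in> A \<inter> zorbit odometer_action \<alpha>"
    "odometer_action (h - h' + k) \<alpha> \<in> A \<inter> zorbit odometer_action \<alpha>"
    using inA k k' by (auto simp: zorbit_def)
  ultimately show False using disj h(1-3) by (metis disjoint_iff imageI)
qed

section \<open>A dense \<open>G\<^sub>\<delta>\<close> of measure zero\<close>

text \<open>Block \<open>n\<close> starts at \<open>n\<close>, so changing finitely many digits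
  affects only finitely many blocks. It has length \<open>n\<close>, which makes the resulting
  measure bounds \<open>(1 / 2) ^ n\<close> summable.\<close>

definition zero_blocks :: "(nat \<Rightarrow> bool) set" where
  "zero_blocks = {\<alpha> \<in> odometer_space. infinite {n. \<forall>i\<in>{n..<2 * n}. \<not> \<alpha> i}}"

lemma zero_blocks_nonempty: "zero_blocks \<noteq> {}"
proof -
  \<comment> \<open>Ones exactly at the powers of 4. No power of 4 lies in
    \<open>{2 * 4 ^ j..<4 * 4 ^ j}\<close>, so this is a zero block for
    \<open>n = 2 * 4 ^ j\<close>.\<close>
  define \<alpha> :: "nat \<Rightarrow> bool" where "\<alpha> i = (\<exists>j. i = 4 ^ j)" for i
  have gap: "\<not> \<alpha> i" if i: "2 * 4 ^ j \<le> i" "i < 4 * 4 ^ j" for i j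
  proof
    assume "\<alpha> i"
    then obtain l where l: "i = 4 ^ l" by (auto simp: \<alpha>_def)
    have "(4::nat) ^ j < 4 ^ l" using i(1) l zero_less_power[of "4::nat" j] by linarith
    moreover have "(4::nat) ^ l < 4 ^ Suc j" using i(2) l by simp
    ultimately show False by (simp del: power_Suc)
  qed
  have no_2_4: "\<not> \<alpha> (2 * 4 ^ j)" for j by (rule gap[of j]) auto
  have inf4: "infinite (range (\<lambda>j. c * 4 ^ j :: nat))" if "c > 0" for c
    using that by (intro range_inj_infinite injI) (simp add: power_inject_exp)
  have "infinite {i. \<alpha> i}"
    by (rule infinite_super[OF _ inf4[of 1]]) (auto simp: \<alpha>_def)
  moreover have "infinite {i. \<not> \<alpha> i}"
    by (rule infinite_super[OF _ inf4[of 2]]) (auto simp: no_2_4)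
  moreover have "infinite {n. \<forall>i\<in>{n..<2 * n}. \<not> \<alpha> i}"
    by (rule infinite_super[OF _ inf4[of 2]]) (auto dest: gap)
  ultimately show ?thesis by (auto simp: zero_blocks_def odometer_space_def)
qed

lemma zero_blocks_tail_equiv:
  assumes "tail_equiv \<alpha> \<beta>" "\<alpha> \<in> zero_blocks"
  shows "\<beta> \<in> zero_blocks"
proof -
  from assms(1) obtain N where N: "\<forall>i\<ge>N. \<alpha> i = \<beta> i" by (auto simp: tail_equiv_def)
  have "{n. \<forall>i\<in>{n..<2 * n}. \<not> \<alpha> i} \<subseteq> {..<N} \<union> {n. \<forall>i\<in>{n..<2 * n}. \<not> \<beta> i}"
    using N by (auto simp: not_less)
  with assms odometer_space_tail_equiv show ?thesis
    unfolding zero_blocks_def by (auto dest: finite_subset)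
qed

lemma zinvariant_zero_blocks: "zinvariant odometer_action zero_blocks"
  unfolding zinvariant_def
proof (intro allI subset_antisym subsetI)
  have stable: "odometer_action n \<alpha> \<in> zero_blocks" if "\<alpha> \<in> zero_blocks" for n \<alpha>
    using that tail_equiv_odometer_action zero_blocks_tail_equiv by (auto simp: zero_blocks_def)
  fix n \<alpha>
  show "\<alpha> \<in> zero_blocks" if "\<alpha> \<in> odometer_action n ` zero_blocks" using that stable by blast
  assume \<alpha>: "\<alpha> \<in> zero_blocks"
  then have "odometer_action n (odometer_action (- n) \<alpha>) = \<alpha>"
    using odometer_action_add[of \<alpha> n "- n"] by (simp add: zero_blocks_def odometer_action_0)
  with stable[OF \<alpha>, of "- n"] show "\<alpha> \<in> odometer_action n ` zero_blocks" by (metis imageI)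
qed

text \<open>The upper limit of open sets is the intersection over \<open>m\<close> of the open
  unions over \<open>n \<ge> m\<close>.\<close>

lemma gdelta_in_frequently_open:
  assumes "\<And>n :: nat. open (V n)"
  shows "gdelta_in euclidean {x. infinite {n. x \<in> V n}}"
proof -
  have "gdelta_in euclidean (\<Inter>(range (\<lambda>m. \<Union>n\<in>{m..}. V n)))"
  proof (rule gdelta_in_Inter)
    fix S assume "S \<in> range (\<lambda>m. \<Union>n\<in>{m..}. V n)"
    then have "open S" using assms by blast
    then show "gdelta_in euclidean S" by (simp add: open_imp_gdelta_in)
  qed auto
  moreover have "\<Inter>(range (\<lambda>m. \<Union>n\<in>{m..}. V n)) = {x. infinite {n. x \<in> V n}}"
    by (auto simp: infinite_nat_iff_unbounded_le)
  ultimately show ?thesis by simp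
qed

text \<open>Three upper limits of open digit conditions are intersected: infinitely many zero
  blocks, infinitely many ones, infinitely many zeros.\<close>

lemma gdelta_in_zero_blocks: "gdelta_in euclidean zero_blocks"
proof -
  have digit: "open {\<alpha> :: nat \<Rightarrow> bool. P (\<alpha> i)}" for i P
  proof -
    have "open ((\<lambda>\<alpha> :: nat \<Rightarrow> bool. \<alpha> i) -` Collect P)"
      by (intro open_vimage discrete_topology_class.open_discrete continuous_on_product_coordinates)
    then show ?thesis by (simp add: vimage_def)
  qed
  have "open (\<Inter>i\<in>{n..<2 * n}. {\<alpha> :: nat \<Rightarrow> bool. \<not> \<alpha> i})" for n
    by (intro open_INT) (auto simp: digit)
  then have "gdelta_in euclidean {\<alpha> :: nat \<Rightarrow> bool. infinite {n. \<alpha> \<in> (\<Inter>i\<in>{n..<2 * n}. {\<alpha>. \<not> \<alpha> i})}}"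
    by (rule gdelta_in_frequently_open)
  moreover have "gdelta_in euclidean {\<alpha> :: nat \<Rightarrow> bool. infinite {n. \<alpha> \<in> {\<alpha>. \<alpha> n}}}"
    "gdelta_in euclidean {\<alpha> :: nat \<Rightarrow> bool. infinite {n. \<alpha> \<in> {\<alpha>. \<not> \<alpha> n}}}"
    by (rule gdelta_in_frequently_open, rule digit)+
  ultimately have "gdelta_in euclidean
      ({\<alpha> :: nat \<Rightarrow> bool. infinite {n. \<alpha> \<in> (\<Inter>i\<in>{n..<2 * n}. {\<alpha>. \<not> \<alpha> i})}} \<inter>
        ({\<alpha>. infinite {n. \<alpha> \<in> {\<alpha>. \<alpha> n}}} \<inter> {\<alpha>. infinite {n. \<alpha> \<in> {\<alpha>. \<not> \<alpha> n}}}))"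
    by (intro gdelta_in_Int)
  moreover have "\<dots> = zero_blocks" by (auto simp: zero_blocks_def odometer_space_def)
  ultimately show ?thesis by simp
qed

text \<open>The translates by \<open>j * 2 ^ n\<close> with \<open>j < 2 ^ n\<close> are pairwise disjoint, since they read \<open>j\<close> in
  the digits from \<open>n\<close> to \<open>2 * n - 1\<close>.\<close>

lemma measure_zero_block_le:
  assumes M: "invariant_borel_prob (top_of_set Y) odometer_action M"
    and Y: "Y \<subseteq> odometer_space" "zinvariant odometer_action Y"
  defines "E \<equiv> \<lambda>n. {\<alpha> \<in> Y. prefix_value (2 * n) \<alpha> < 2 ^ n}"
  shows "E n \<in> sets M" "measure M (E n) \<le> (1 / 2) ^ n"
proof -
  interpret prob_space M using M by (simp add: invariant_borel_prob_def)
  have sets_M: "sets M = sigma_sets Y {U. openin (top_of_set Y) U}" "space M = Y"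
    using M by (auto simp: invariant_borel_prob_def)
  have inv: "emeasure M (odometer_action k ` B) = emeasure M B" if "B \<in> sets M" for k B
    using M that by (simp add: invariant_borel_prob_def)
  have meas: "{\<alpha> \<in> Y. prefix_value m \<alpha> \<in> V} \<in> sets M" for m V
  proof -
    have "openin (top_of_set Y) (Y \<inter> {\<alpha>. prefix_value m \<alpha> \<in> V})"
      by (intro openin_open_Int open_prefix_value_vimage)
    then show ?thesis unfolding sets_M by (auto intro: sigma_sets.Basic simp: Int_def)
  qed
  show E: "E n \<in> sets M" using meas[of "2 * n" "{..<2 ^ n}"] by (simp add: E_def)
  \<comment> \<open>For \<open>j < 2 ^ n\<close>, \<open>F j\<close> consists of the points of
    \<open>Y\<close> whose digits from \<open>n\<close> to \<open>2 * n - 1\<close> encode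
    \<open>j\<close>.\<close>
  define F where "F j = {\<alpha> \<in> Y. prefix_value (2 * n) \<alpha> \<in> {int j * 2 ^ n..<(int j + 1) * 2 ^ n}}" for j
  have F: "F j \<in> sets M" for j unfolding F_def by (rule meas)
  have le: "measure M (E n) \<le> measure M (F j)" if j: "j < 2 ^ n" for j
  proof -
    have img: "odometer_action (int j * 2 ^ n) ` E n \<subseteq> F j"
    proof (clarsimp simp: E_def F_def)
      fix \<alpha> assume \<alpha>: "\<alpha> \<in> Y" "prefix_value (2 * n) \<alpha> < 2 ^ n"
      let ?v = "prefix_value (2 * n) \<alpha>"
      have v: "0 \<le> ?v" using prefix_value_bounds by blast
      \<comment> \<open>This bound excludes wrap-around modulo \<open>2 ^ (2 * n)\<close>: the sum
        stays below \<open>(int j + 1) * 2 ^ n\<close>.\<close>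
      have "int j + 1 \<le> 2 ^ n" using j by (metis Suc_leI of_nat_Suc of_nat_le_iff of_nat_numeral of_nat_power add.commute)
      then have "(int j + 1) * 2 ^ n \<le> 2 ^ n * 2 ^ n" by (rule mult_right_mono) simp
      also have "\<dots> = (2 :: int) ^ (2 * n)" by (simp add: power_add mult_2)
      finally have top: "(int j + 1) * 2 ^ n \<le> 2 ^ (2 * n)" .
      have "?v + int j * 2 ^ n < (int j + 1) * 2 ^ n" using \<alpha>(2) by (simp add: distrib_right)
      with top v have "(?v + int j * 2 ^ n) mod 2 ^ (2 * n) = ?v + int j * 2 ^ n"
        by (intro mod_pos_pos_trivial) auto
      then have "prefix_value (2 * n) (odometer_action (int j * 2 ^ n) \<alpha>) = ?v + int j * 2 ^ n"
        using \<alpha>(1) Y(1) by (subst prefix_value_odometer_action) auto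
      moreover have "odometer_action (int j * 2 ^ n) \<alpha> \<in> Y"
        using \<alpha>(1) Y(2) by (auto simp: zinvariant_def)
      ultimately show "odometer_action (int j * 2 ^ n) \<alpha> \<in> Y \<and>
          int j * 2 ^ n \<le> prefix_value (2 * n) (odometer_action (int j * 2 ^ n) \<alpha>) \<and>
          prefix_value (2 * n) (odometer_action (int j * 2 ^ n) \<alpha>) < (int j + 1) * 2 ^ n"
        using v \<alpha>(2) by (simp add: distrib_right)
    qed
    have "emeasure M (E n) \<le> emeasure M (F j)"
      using emeasure_mono[OF img F] inv[OF E] by simp
    then show ?thesis by (simp add: emeasure_eq_measure)
  qed
  have "disjoint_family_on F {..<2 ^ n}"
    unfolding disjoint_family_on_def
  proof (intro ballI impI)
    fix i j :: nat assume "i \<noteq> j"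
    then have "(int i + 1) * 2 ^ n \<le> int j * 2 ^ n \<or> (int j + 1) * 2 ^ n \<le> int i * 2 ^ n"
      by (cases "i < j") (auto intro!: mult_right_mono)
    moreover have "int l * 2 ^ n \<le> prefix_value (2 * n) \<alpha>"
      "prefix_value (2 * n) \<alpha> < (int l + 1) * 2 ^ n" if "\<alpha> \<in> F l" for \<alpha> l
      using that by (simp_all add: F_def)
    ultimately have "\<alpha> \<notin> F j" if "\<alpha> \<in> F i" for \<alpha>
      using that by (meson leD le_less_trans order_trans)
    then show "F i \<inter> F j = {}" by blast
  qed
  then have "(\<Sum>j<2 ^ n. measure M (F j)) = measure M (\<Union>j<2 ^ n. F j)"
    using F by (intro finite_measure_finite_Union[symmetric]) auto
  also have "\<dots> \<le> 1" by simp
  finally have "(\<Sum>j<2 ^ n. measure M (F j)) \<le> 1" .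
  moreover have "(\<Sum>j<(2::nat) ^ n. measure M (E n)) \<le> (\<Sum>j<2 ^ n. measure M (F j))"
    using le by (intro sum_mono) auto
  ultimately have "2 ^ n * measure M (E n) \<le> 1" by simp
  then show "measure M (E n) \<le> (1 / 2) ^ n" by (simp add: field_simps)
qed

lemma no_invariant_borel_prob_zero_blocks:
  "\<not> invariant_borel_prob (top_of_set zero_blocks) odometer_action M"
proof
  assume M: "invariant_borel_prob (top_of_set zero_blocks) odometer_action M"
  interpret prob_space M using M by (simp add: invariant_borel_prob_def)
  \<comment> \<open>The inequality holds exactly when the digits from \<open>n\<close> to
    \<open>2 * n - 1\<close> vanish.\<close>
  define E where "E n = {\<alpha> \<in> zero_blocks. prefix_value (2 * n) \<alpha> < 2 ^ n}" for n
  have E: "E n \<in> sets M" "measure M (E n) \<le> (1 / 2) ^ n" for n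
    using measure_zero_block_le[OF M _ zinvariant_zero_blocks]
    by (auto simp: E_def zero_blocks_def)
  have "summable (\<lambda>n. measure M (E n))"
    by (rule summable_comparison_test'[OF summable_geometric[of "1 / 2 :: real"]]) (use E(2) in auto)
  \<comment> \<open>Almost every point lies in only finitely many \<open>E n\<close>, whereas every
    point of \<open>zero_blocks\<close> lies in infinitely many.\<close>
  then have "AE \<alpha> in M. eventually (\<lambda>n. \<alpha> \<in> space M - E n) sequentially"
    using E(1) by (intro borel_cantelli_AE1) (auto simp: emeasure_eq_measure)
  moreover have "\<not> eventually (\<lambda>n. \<alpha> \<in> space M - E n) sequentially" if "\<alpha> \<in> space M" for \<alpha>
  proof
    assume "eventually (\<lambda>n. \<alpha> \<in> space M - E n) sequentially"
    then obtain N where N: "\<forall>n\<ge>N. \<alpha> \<notin> E n" by (auto simp: eventually_sequentially)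
    have \<alpha>: "\<alpha> \<in> zero_blocks" using that M by (simp add: invariant_borel_prob_def)
    then obtain n where n: "n \<ge> N" "\<forall>i\<in>{n..<2 * n}. \<not> \<alpha> i"
      by (auto simp: zero_blocks_def infinite_nat_iff_unbounded_le)
    then have "prefix_value (2 * n) \<alpha> = prefix_value n \<alpha>" by (intro prefix_value_zero_block) auto
    then have "\<alpha> \<in> E n" using \<alpha> prefix_value_bounds by (simp add: E_def)
    with N n(1) show False by blast
  qed
  ultimately have "AE \<alpha> in M. False" by (auto elim!: AE_mp)
  then show False by simp
qed

theorem corollary11p11:
  shows "\<exists>Y :: (nat \<Rightarrow> bool) set.
      Y \<subseteq> odometer_space \<and>
      zinvariant odometer_action Y \<and>
      gdelta_in (top_of_set odometer_space) Y \<and>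
      top_of_set odometer_space closure_of Y = odometer_space \<and>
      polish_zspace (top_of_set Y) odometer_action \<and>
      generically_ergodic (top_of_set Y) odometer_action \<and>
      (\<nexists>M. invariant_borel_prob (top_of_set Y) odometer_action M) \<and>
      (\<nexists>A. baire_measurable_in (top_of_set Y) A \<and> \<not> meager_in (top_of_set Y) A \<and>
           locally_weakly_wandering (top_of_set Y) odometer_action A) \<and>
      (\<nexists>\<P>. partition_on Y \<P> \<and> baire_countably_generated (top_of_set Y) \<P> \<and>
           (\<forall>P\<in>\<P>. zinvariant odometer_action P \<and>
              (\<exists>S. baire_measurable_in (top_of_set Y) S \<and>
                   weakly_wandering odometer_action S \<and>
                   complete_section (top_of_set Y) odometer_action P S)))"
proof (intro exI[of _ zero_blocks] conjI)
  let ?Y = "top_of_set zero_blocks"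
  show sub: "zero_blocks \<subseteq> odometer_space" by (auto simp: zero_blocks_def)
  show "zinvariant odometer_action zero_blocks" by (rule zinvariant_zero_blocks)
  show "gdelta_in (top_of_set odometer_space) zero_blocks"
    using gdelta_in_zero_blocks sub by (auto simp: gdelta_in_subtopology)
  show polish: "polish_zspace ?Y odometer_action"
    by (rule polish_zspace_odometer[OF sub zinvariant_zero_blocks gdelta_in_zero_blocks])
  \<comment> \<open>An orbit starting in \<open>zero_blocks\<close> stays there by invariance. One
    such orbit gives density in \<open>odometer_space\<close>; the density of all of them gives
    generic ergodicity.\<close>
  have dense: "\<exists>k. odometer_action k \<alpha> \<in> zero_blocks \<inter> U"
    if "\<alpha> \<in> zero_blocks" "open U" "U \<noteq> {}" for \<alpha> U
    using odometer_orbit_dense[of \<alpha> U] zaction_in_topspace[OF polish] that sub by fastforce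
  show "top_of_set odometer_space closure_of zero_blocks = odometer_space"
    using dense zero_blocks_nonempty sub
    by (fastforce simp: closure_of_def openin_open)
  show ergodic: "generically_ergodic ?Y odometer_action"
  proof (rule generically_ergodic_if_orbits_dense[OF polish])
    fix U \<alpha> assume "openin ?Y U" "U \<noteq> {}" "\<alpha> \<in> topspace ?Y"
    then show "\<exists>k. odometer_action k \<alpha> \<in> U" using dense by (auto simp: openin_open)
  qed
  show "\<nexists>M. invariant_borel_prob ?Y odometer_action M"
    using no_invariant_borel_prob_zero_blocks by blast
  have meager: "meager_in ?Y A"
    if "baire_measurable_in ?Y A" "locally_weakly_wandering ?Y odometer_action A" for A
    using odometer_locally_weakly_wandering_meager[OF polish sub zero_blocks_nonempty that] .
  then show "\<nexists>A. baire_measurable_in ?Y A \<and> \<not> meager_in ?Y A \<and>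
      locally_weakly_wandering ?Y odometer_action A"
    by blast
  show "\<nexists>\<P>. partition_on zero_blocks \<P> \<and> baire_countably_generated ?Y \<P> \<and>
      (\<forall>P\<in>\<P>. zinvariant odometer_action P \<and>
        (\<exists>S. baire_measurable_in ?Y S \<and> weakly_wandering odometer_action S \<and>
          complete_section ?Y odometer_action P S))"
    using no_countably_generated_wandering_partition[OF polish _ ergodic meager] zero_blocks_nonempty
    by (metis topspace_euclidean_subtopology)
qed

end
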